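(* Let $E$ be an equivalence on a set $U$ and let $T$ be an $E$-compatible tolerance on $U$. Then $\mathit{RS}(E,T) = \{(X_E, X^T) \mid X \subseteq U\}$, ordered by coordinatewise inclusion, is a complete lattice such that for any $\mathcal{H} \subseteq \wp(U)$, \[ \bigvee_{X \in \mathcal{H}} (X_E, X^T) = \Big( \bigcup_{X \in \mathcal{H}} X_E, \ \bigcup_{X \in \mathcal{H}} X^T \Big) \] and \[ \bigwedge_{X\in\mathcal{H}} (X_{E},X^T) = \Big( \bigcap_{X\in\mathcal{H}} X_E, \ \Big( \Big(\bigcap_{X \in \mathcal{H}} (X^T)_T \Big) \setminus \Sigma_E(\mathcal{H}) \Big)^T \Big), \] where \[ \Sigma_E(\mathcal{H}) = \Big( \Big( \bigcap_{X\in\mathcal{H}} (X^T)_T \Big) \setminus \bigcap_{X\in\mathcal{H}} X_E \Big) \cap \Sigma_E . \]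
   Context: A tolerance is a reflexive and symmetric binary relation. For a binary relation $R$ on $U$ and $x \in U$, $R(x) = \{y \in U \mid x \, R \, y\}$; for an equivalence $E$, $[x]_E = E(x)$. For $X \subseteq U$, $X_R = \{x \in U \mid R(x) \subseteq X\}$ and $X^R = \{x \in U \mid R(x) \cap X \neq \emptyset\}$. The product of relations is $R \circ S = \{(x,y) \mid (\exists z \in U)\ x \, R \, z \text{ and } z \, S \, y\}$. A tolerance $T$ is $E$-compatible if $E \circ T \subseteq T$. $\wp(U)$ is the power set of $U$. The intersection of an empty family of subsets of $U$ is $U$. The set $\Sigma_E = \{x \in U \mid [x]_E = \{x\}\}$ consists of the elements whose $E$-class is a singleton. Coordinatewise inclusion: $(A,B) \leq (C,D)$ iff $A \subseteq C$ and $B \subseteq D$. *)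

theory Defs
  imports "HOL-Algebra.Complete_Lattice"
begin

definition tolerance :: "'a set \<Rightarrow> 'a rel \<Rightarrow> bool" where
  "tolerance U T \<longleftrightarrow> T \<subseteq> U \<times> U \<and> refl_on U T \<and> sym T"

text \<open>
  \<^term>\<open>E O T\<close> composes from left to right: first \<^term>\<open>E\<close>, then \<^term>\<open>T\<close>.
\<close>

definition compatible :: "'a rel \<Rightarrow> 'a rel \<Rightarrow> bool" where
  "compatible E T \<longleftrightarrow> E O T \<subseteq> T"

text \<open>
  For a relation \<^term>\<open>R\<close> on \<^term>\<open>U\<close>, the neighbourhood $R(x)$ is the image \<^term>\<open>R `` {x}\<close>;
  no intersection with \<^term>\<open>U\<close> is needed because the relations used here are included
  in \<^term>\<open>U \<times> U\<close>. Below, \<^term>\<open>lower U R X\<close> stands for $X_R$ and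
  \<^term>\<open>upper U R X\<close> for $X^R$.
\<close>

definition lower :: "'a set \<Rightarrow> 'a rel \<Rightarrow> 'a set \<Rightarrow> 'a set" where
  "lower U R X = {x \<in> U. R `` {x} \<subseteq> X}"

definition upper :: "'a set \<Rightarrow> 'a rel \<Rightarrow> 'a set \<Rightarrow> 'a set" where
  "upper U R X = {x \<in> U. R `` {x} \<inter> X \<noteq> {}}"

definition rough_pair :: "'a set \<Rightarrow> 'a rel \<Rightarrow> 'a rel \<Rightarrow> 'a set \<Rightarrow> 'a set \<times> 'a set" where
  "rough_pair U E T X = (lower U E X, upper U T X)"

definition RS :: "'a set \<Rightarrow> 'a rel \<Rightarrow> 'a rel \<Rightarrow> ('a set \<times> 'a set) gorder" where
  "RS U E T =
     \<lparr>carrier = {rough_pair U E T X | X. X \<subseteq> U},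
      eq = (=),
      le = (\<lambda>(A, B) (C, D). A \<subseteq> C \<and> B \<subseteq> D)\<rparr>"

definition singleton_elems :: "'a set \<Rightarrow> 'a rel \<Rightarrow> 'a set" where
  "singleton_elems U E = {x \<in> U. E `` {x} = {x}}"

text \<open>
  Intersections of families of subsets of \<^term>\<open>U\<close> are taken within \<^term>\<open>U\<close>: the empty
  family has intersection \<^term>\<open>U\<close>, not \<^term>\<open>UNIV\<close>.
\<close>

definition Inter_in :: "'a set \<Rightarrow> 'a set set \<Rightarrow> 'a set" where
  "Inter_in U \<A> = U \<inter> \<Inter>\<A>"

definition Sigma_fam :: "'a set \<Rightarrow> 'a rel \<Rightarrow> 'a rel \<Rightarrow> 'a set set \<Rightarrow> 'a set" where
  "Sigma_fam U E T \<H> =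
     (Inter_in U ((\<lambda>X. lower U T (upper U T X)) ` \<H>) - Inter_in U (lower U E ` \<H>))
       \<inter> singleton_elems U E"

end

theory Submission
  imports Defs
begin

text \<open>
  A compatible tolerance does not distinguish \<open>E\<close>-equivalent points, so thinning
  an \<open>E\<close>-class of \<open>Y\<close> down to a single representative leaves the upper approximation of \<open>Y\<close>
  unchanged, while it removes every class with at least two elements from the lower approximation.
  Hence a pair \<open>(A, Y\<^sup>T)\<close> with \<open>A \<subseteq> Y\<close> and \<open>A\<close> saturated under \<open>E\<close> is a rough pair as soon as
  all points of \<open>Y\<close> with a singleton class lie in \<open>A\<close>. Both candidate bounds have this shape;
  for the meet, removing \<open>\<Sigma>\<^sub>E(\<H>)\<close> is exactly what enforces the last condition.
\<close>

lemma tolerance_sym: "tolerance U T \<Longrightarrow> (x, y) \<in> T \<Longrightarrow> (y, x) \<in> T"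
  by (auto simp: tolerance_def sym_def)

lemma tolerance_in: "tolerance U T \<Longrightarrow> (x, y) \<in> T \<Longrightarrow> x \<in> U \<and> y \<in> U"
  by (auto simp: tolerance_def)

lemma lower_closed:
  assumes "equiv U E" "x \<in> lower U E X" "(x, y) \<in> E"
  shows "y \<in> lower U E X"
  using assms equiv_class_eq[OF assms(1,3)] by (auto simp: lower_def equiv_def)

lemma lower_subset:
  assumes "equiv U E"
  shows "lower U E X \<subseteq> X"
  using equiv_class_self[OF assms] by (auto simp: lower_def)

text \<open>A one-point class cannot be thinned: any set meeting it contains it. Hence the join
  needs no correction term, and the set of any lower bound in the meet avoids
  \<open>Sigma_fam\<close>.\<close>

lemma singleton_elems_subset_lower: "X \<inter> singleton_elems U E \<subseteq> lower U E X"
proof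
  fix x assume "x \<in> X \<inter> singleton_elems U E"
  then show "x \<in> lower U E X" by (simp add: singleton_elems_def lower_def)
qed

text \<open>Symmetry of \<open>T\<close> makes \<open>upper U T\<close> left adjoint to
  \<open>lower U T\<close> on subsets of \<open>U\<close>; this is the unit, and
  \<open>upper_lower_decreasing\<close> is the counit.\<close>

lemma lower_upper_increasing:
  assumes "tolerance U T" "X \<subseteq> U"
  shows "X \<subseteq> lower U T (upper U T X)"
proof
  fix x assume x: "x \<in> X"
  have "y \<in> upper U T X" if "(x, y) \<in> T" for y
    using that x tolerance_sym[OF assms(1) that] tolerance_in[OF assms(1) that]
    by (auto simp: upper_def)
  with x assms(2) show "x \<in> lower U T (upper U T X)" by (auto simp: lower_def)
qed

lemma upper_lower_decreasing:
  assumes "tolerance U T"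
  shows "upper U T (lower U T X) \<subseteq> X"
  using tolerance_sym[OF assms] unfolding upper_def lower_def by blast

lemma lower_mono: "X \<subseteq> Y \<Longrightarrow> lower U R X \<subseteq> lower U R Y"
  by (auto simp: lower_def)

lemma upper_mono: "X \<subseteq> Y \<Longrightarrow> upper U R X \<subseteq> upper U R Y"
  by (auto simp: upper_def)

lemma carrier_RS: "carrier (RS U E T) = rough_pair U E T ` Pow U"
  by (auto simp: RS_def)

lemma saturated_pair_in_RS:
  assumes E: "equiv U E" and T: "tolerance U T" and ET: "compatible E T"
    and Y: "Y \<subseteq> U" and AY: "A \<subseteq> Y"
    and closed: "\<And>x y. x \<in> A \<Longrightarrow> (x, y) \<in> E \<Longrightarrow> y \<in> A"
    and sing: "Y \<inter> singleton_elems U E \<subseteq> A"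
  shows "(A, upper U T Y) \<in> carrier (RS U E T)"
proof -
  \<comment> \<open>The choice depends only on the class of \<open>y\<close>, so equivalent points
    get the same representative. It need not lie in \<open>Y\<close>.\<close>
  define f where "f y = (SOME z. z \<in> E `` {y})" for y
  have f: "(y, f y) \<in> E" if "y \<in> U" for y
    using someI[of "\<lambda>z. z \<in> E `` {y}" y] equiv_class_self[OF E that] by (simp add: f_def)
  have f_eq: "f x = f y" if "(x, y) \<in> E" for x y
    using equiv_class_eq[OF E that] by (simp add: f_def)
  have E_in: "x \<in> U" "y \<in> U" if "(x, y) \<in> E" for x y
    using that E by (auto simp: equiv_def)
  have E_sym: "(y, x) \<in> E" if "(x, y) \<in> E" for x y
    using that E by (auto simp: equiv_def sym_def)
  have E_trans: "(x, z) \<in> E" if "(x, y) \<in> E" "(y, z) \<in> E" for x y z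
    using that E by (auto simp: equiv_def dest: transD)
  \<comment> \<open>Symmetry of both relations turns \<open>E O T \<subseteq> T\<close> into
    \<open>T O E \<subseteq> T\<close>.\<close>
  have T_E: "(x, z) \<in> T" if "(x, y) \<in> T" "(y, z) \<in> E" for x y z
    using that ET tolerance_sym[OF T] E_sym unfolding compatible_def by blast
  define Z where "Z = A \<union> f ` Y"
  have "Z \<subseteq> U" using AY Y f E_in unfolding Z_def by blast
  moreover have "lower U E Z = A"
  proof
    show "A \<subseteq> lower U E Z" using AY Y closed by (auto simp: lower_def Z_def)
    show "lower U E Z \<subseteq> A"
    proof (rule subsetI, rule ccontr)
      fix x assume x: "x \<in> lower U E Z" and nA: "x \<notin> A"
      have xU: "x \<in> U" and cl: "\<And>y. (x, y) \<in> E \<Longrightarrow> y \<in> Z" using x by (auto simp: lower_def)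
      have xx: "(x, x) \<in> E" using equiv_class_self[OF E xU] by simp
      \<comment> \<open>As \<open>A\<close> is saturated, the class of \<open>x\<close> misses
        \<open>A\<close>, so each of its points is some \<open>f w\<close> with \<open>w\<close> in
        \<open>Y\<close>. That \<open>w\<close> is equivalent to \<open>x\<close>, so every point of
        the class equals \<open>f x\<close>.\<close>
      have rep: "\<exists>w\<in>Y. (x, w) \<in> E \<and> y = f x" if y: "(x, y) \<in> E" for y
      proof -
        have "y \<notin> A" using closed E_sym nA y by blast
        then obtain w where w: "w \<in> Y" "y = f w" using cl[OF y] by (auto simp: Z_def)
        have "(x, w) \<in> E" using f w Y y E_sym E_trans by blast
        with w f_eq show ?thesis by auto
      qed
      have "y = x" if "(x, y) \<in> E" for y using rep[OF that] rep[OF xx] by auto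
      then have "E `` {x} = {x}" using xx by auto
      \<comment> \<open>The point \<open>w\<close> of \<open>Y\<close> lies in the class of
        \<open>x\<close>, which is now known to be \<open>{x}\<close>.\<close>
      moreover have "x \<in> Y"
      proof -
        obtain w where "w \<in> Y" "(x, w) \<in> E" using rep[OF xx] by blast
        with calculation show ?thesis by auto
      qed
      ultimately show False using sing nA xU by (auto simp: singleton_elems_def)
    qed
  qed
  moreover have "upper U T Z = upper U T Y"
  proof
    show "upper U T Z \<subseteq> upper U T Y"
      using AY T_E f E_sym Y unfolding upper_def Z_def by blast
    show "upper U T Y \<subseteq> upper U T Z"
      using T_E f Y unfolding upper_def Z_def by blast
  qed
  ultimately show ?thesis by (force simp: carrier_RS rough_pair_def)
qed

lemma le_RS: "p \<sqsubseteq>\<^bsub>RS U E T\<^esub> q \<longleftrightarrow> fst p \<subseteq> fst q \<and> snd p \<subseteq> snd q"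
  by (auto simp: RS_def split: prod.splits)

lemma eq_RS: "p .=\<^bsub>RS U E T\<^esub> q \<longleftrightarrow> p = q"
  by (simp add: RS_def)

lemma partial_order_RS: "partial_order (RS U E T)"
  by unfold_locales (auto simp: le_RS eq_RS prod_eq_iff, simp add: RS_def)

lemma Upper_RS:
  assumes "\<H> \<subseteq> Pow U"
  shows "Upper (RS U E T) (rough_pair U E T ` \<H>) =
    {p \<in> carrier (RS U E T). \<forall>X\<in>\<H>. lower U E X \<subseteq> fst p \<and> upper U T X \<subseteq> snd p}"
proof -
  \<comment> \<open>\<open>Upper\<close> only tests members that lie in the carrier; here all of
    them do.\<close>
  have carrier: "rough_pair U E T ` \<H> \<inter> carrier (RS U E T) = rough_pair U E T ` \<H>"
    using assms by (auto simp: carrier_RS)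
  show ?thesis
    unfolding Upper_def carrier Ball_def[symmetric] ball_simps le_RS
    unfolding rough_pair_def fst_conv snd_conv by blast
qed

lemma Lower_RS:
  assumes "\<H> \<subseteq> Pow U"
  shows "Lower (RS U E T) (rough_pair U E T ` \<H>) =
    {p \<in> carrier (RS U E T). \<forall>X\<in>\<H>. fst p \<subseteq> lower U E X \<and> snd p \<subseteq> upper U T X}"
proof -
  have carrier: "rough_pair U E T ` \<H> \<inter> carrier (RS U E T) = rough_pair U E T ` \<H>"
    using assms by (auto simp: carrier_RS)
  show ?thesis
    unfolding Lower_def carrier Ball_def[symmetric] ball_simps le_RS
    unfolding rough_pair_def fst_conv snd_conv by blast
qed

text \<open>Upper approximation commutes with unions, but \<open>lower U E (\<Union>\<H>)\<close>
  may exceed the union of the lower approximations. The realizing set is therefore a thinning of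
  \<open>\<Union>\<H>\<close>, not \<open>\<Union>\<H>\<close> itself.\<close>

lemma least_join:
  assumes E: "equiv U E" and T: "tolerance U T" and ET: "compatible E T"
    and H: "\<H> \<subseteq> Pow U"
  shows "least (RS U E T) (\<Union>X\<in>\<H>. lower U E X, \<Union>X\<in>\<H>. upper U T X)
    (Upper (RS U E T) (rough_pair U E T ` \<H>))"
proof -
  have up: "upper U T (\<Union>\<H>) = (\<Union>X\<in>\<H>. upper U T X)" by (auto simp: upper_def)
  have low: "(\<Union>X\<in>\<H>. lower U E X) \<subseteq> \<Union>\<H>" using lower_subset[OF E] by blast
  have sing: "\<Union>\<H> \<inter> singleton_elems U E \<subseteq> (\<Union>X\<in>\<H>. lower U E X)"
    using singleton_elems_subset_lower[of _ U E] by blast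
  have "\<Union>\<H> \<subseteq> U" using H by blast
  moreover have "y \<in> (\<Union>X\<in>\<H>. lower U E X)"
    if "x \<in> (\<Union>X\<in>\<H>. lower U E X)" "(x, y) \<in> E" for x y
    using that lower_closed[OF E] by blast
  ultimately have "(\<Union>X\<in>\<H>. lower U E X, \<Union>X\<in>\<H>. upper U T X) \<in> carrier (RS U E T)"
    using saturated_pair_in_RS[OF E T ET _ low _ sing] unfolding up by simp
  then show ?thesis unfolding least_def Upper_RS[OF H] by (auto simp: le_RS)
qed

lemma greatest_meet:
  assumes E: "equiv U E" and T: "tolerance U T" and ET: "compatible E T"
    and H: "\<H> \<subseteq> Pow U"
  shows "greatest (RS U E T)
    (Inter_in U (lower U E ` \<H>),
     upper U T (Inter_in U ((\<lambda>X. lower U T (upper U T X)) ` \<H>) - Sigma_fam U E T \<H>))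
    (Lower (RS U E T) (rough_pair U E T ` \<H>))"
proof -
  let ?A = "Inter_in U (lower U E ` \<H>)"
  let ?D = "Inter_in U ((\<lambda>X. lower U T (upper U T X)) ` \<H>)"
  let ?W = "?D - Sigma_fam U E T \<H>"
  have WU: "?W \<subseteq> U" by (auto simp: Inter_in_def)
  have "lower U E X \<subseteq> lower U T (upper U T X)" if "X \<in> \<H>" for X
    using lower_subset[OF E] lower_upper_increasing[OF T] that H by blast
  then have "?A \<subseteq> ?D" unfolding Inter_in_def by blast
  then have AW: "?A \<subseteq> ?W" by (auto simp: Sigma_fam_def)
  have closed: "y \<in> ?A" if "x \<in> ?A" "(x, y) \<in> E" for x y
    using that lower_closed[OF E] E unfolding Inter_in_def by (auto simp: equiv_def)
  have sing: "?W \<inter> singleton_elems U E \<subseteq> ?A" by (auto simp: Sigma_fam_def)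
  have car: "(?A, upper U T ?W) \<in> carrier (RS U E T)"
    by (rule saturated_pair_in_RS[OF E T ET WU AW closed sing])
  have lb: "upper U T ?W \<subseteq> upper U T X" if "X \<in> \<H>" for X
  proof -
    have "?W \<subseteq> lower U T (upper U T X)" using that by (auto simp: Inter_in_def)
    then show ?thesis using upper_mono upper_lower_decreasing[OF T] by blast
  qed
  have greatest: "lower U E Y \<subseteq> ?A \<and> upper U T Y \<subseteq> upper U T ?W"
    if Y: "Y \<subseteq> U" and le: "\<And>X. X \<in> \<H> \<Longrightarrow> lower U E Y \<subseteq> lower U E X \<and> upper U T Y \<subseteq> upper U T X"
    for Y
  proof
    show A: "lower U E Y \<subseteq> ?A" using le by (auto simp: Inter_in_def lower_def)
    \<comment> \<open>By adjunction, \<open>upper U T Y \<subseteq> upper U T X\<close> bounds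
      \<open>Y\<close> itself, so \<open>?D\<close> contains the set of every lower bound.\<close>
    have "Y \<subseteq> lower U T (upper U T X)" if "X \<in> \<H>" for X
      using lower_upper_increasing[OF T Y] lower_mono le[OF that] by blast
    then have "Y \<subseteq> ?D" using Y unfolding Inter_in_def by blast
    \<comment> \<open>A point of \<open>Y\<close> in \<open>Sigma_fam\<close> would have a singleton
      class, hence lie in \<open>lower U E Y\<close> and so in \<open>?A\<close>, which
      \<open>Sigma_fam\<close> excludes.\<close>
    then have "Y \<subseteq> ?W"
      using A singleton_elems_subset_lower[of Y U E] unfolding Sigma_fam_def by blast
    then show "upper U T Y \<subseteq> upper U T ?W" by (rule upper_mono)
  qed
  have "?A \<subseteq> lower U E X" if "X \<in> \<H>" for X using that by (auto simp: Inter_in_def)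
  then have "(?A, upper U T ?W) \<in> Lower (RS U E T) (rough_pair U E T ` \<H>)"
    unfolding Lower_RS[OF H] using car lb by simp
  moreover have "p \<sqsubseteq>\<^bsub>RS U E T\<^esub> (?A, upper U T ?W)"
    if "p \<in> Lower (RS U E T) (rough_pair U E T ` \<H>)" for p
  proof -
    from that obtain Y where "Y \<subseteq> U" "p = rough_pair U E T Y"
      by (auto simp: Lower_RS[OF H] carrier_RS)
    with that greatest[of Y] show ?thesis
      unfolding Lower_RS[OF H] le_RS by (simp add: rough_pair_def)
  qed
  ultimately show ?thesis unfolding greatest_def by (simp add: Lower_def)
qed

theorem theorem3p1:
  fixes U :: "'a set" and E T :: "'a rel"
  assumes "equiv U E"
    and "tolerance U T"
    and "compatible E T"
  shows "complete_lattice (RS U E T) \<and>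
    (\<forall>\<H>. \<H> \<subseteq> Pow U \<longrightarrow>
      \<Squnion>\<^bsub>RS U E T\<^esub> (rough_pair U E T ` \<H>) =
        (\<Union>X\<in>\<H>. lower U E X, \<Union>X\<in>\<H>. upper U T X) \<and>
      \<Sqinter>\<^bsub>RS U E T\<^esub> (rough_pair U E T ` \<H>) =
        (Inter_in U (lower U E ` \<H>),
         upper U T (Inter_in U ((\<lambda>X. lower U T (upper U T X)) ` \<H>) - Sigma_fam U E T \<H>)))"
proof (intro conjI allI impI)
  interpret partial_order "RS U E T" by (rule partial_order_RS)
  note join = least_join[OF assms] and meet = greatest_meet[OF assms]
  show "complete_lattice (RS U E T)"
  proof
    \<comment> \<open>The empty set is included: its meet is the top \<open>(U, U)\<close>, thanks
      to the convention in \<open>Inter_in\<close>.\<close>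
    fix A assume "A \<subseteq> carrier (RS U E T)"
    then obtain \<H> where "\<H> \<subseteq> Pow U" "A = rough_pair U E T ` \<H>"
      by (auto simp: carrier_RS subset_image_iff)
    then show "\<exists>s. least (RS U E T) s (Upper (RS U E T) A)"
      and "\<exists>i. greatest (RS U E T) i (Lower (RS U E T) A)"
      using join meet by blast+
  qed
  fix \<H> :: "'a set set" assume H: "\<H> \<subseteq> Pow U"
  \<comment> \<open>The supremum is defined by choice among least upper bounds; antisymmetry leaves
    only the explicit pair. The infimum is treated dually.\<close>
  show "\<Squnion>\<^bsub>RS U E T\<^esub> (rough_pair U E T ` \<H>) =
      (\<Union>X\<in>\<H>. lower U E X, \<Union>X\<in>\<H>. upper U T X)"
    unfolding sup_def using join[OF H] by (blast intro: some_equality least_unique)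
  show "\<Sqinter>\<^bsub>RS U E T\<^esub> (rough_pair U E T ` \<H>) =
      (Inter_in U (lower U E ` \<H>),
       upper U T (Inter_in U ((\<lambda>X. lower U T (upper U T X)) ` \<H>) - Sigma_fam U E T \<H>))"
    unfolding inf_def using meet[OF H] by (blast intro: some_equality greatest_unique)
qed

end
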